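(* Let $G$ be a simple graph with vertices $v_1,\dots,v_n$ and adjacency matrix $A\in\mathbb F_2^{n\times n}$, and suppose that either (a) every vertex of $G$ has even degree (zero allowed), and put $\bar N:=A^2+\mathbb I$; or (b) every vertex of $G$ has odd degree, and put $\bar N:=A^2$. Let $r$ be the rank of $\bar N$ over $\mathbb F_2$, let $w_1,\dots,w_{n-r}$ be a basis of $\ker\bar N$ and let $J\in\mathbb F_2^{(n-r)\times n}$ have rows $w_1^\top,\dots,w_{n-r}^\top$. Then in the Second Neighbors Lights Out game on $G$, an initial state $i$ can be transformed into a final state $f$ if and only if $Ji=Jf$.
   Context: Second Neighbors Lights Out game on $G$ (played only when all degrees are even/zero, or all degrees are odd): a state is $x\in\mathbb F_2^n$ ($x_j=1$ means the light at $v_j$ is on). Pressing the button at $v_i$ toggles the light at $v_i$ and the light at each vertex $v_k\neq v_i$ that is joined to $v_i$ by an odd number of paths of length $2$ (vertices joined to $v_i$ by an even number of such paths keep their status). All arithmetic is over $\mathbb F_2$. A state $i$ can be transformed into $f$ if some finite sequence of button presses turns $i$ into $f$. *)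

theory Defs
  imports
    "HOL-Library.Z2"
    "Jordan_Normal_Form.Matrix_Kernel"
    "Jordan_Normal_Form.DL_Rank"
    "Graph_Theory.Graph_Theory"
begin

text \<open>
  A simple graph is a \<^locale>\<open>pair_graph\<close>: a finite, loop-free, symmetric digraph without parallel
  arcs, each undirected edge being a pair of opposite arcs. Consequently the degree of a vertex is
  its \<^const>\<open>out_degree\<close>. The vertices are enumerated as \<open>v 0, \<dots>, v (n - 1)\<close>, and
  \<open>\<bbbF>\<^sub>2\<close> is the field \<^typ>\<open>bit\<close>.
\<close>

definition adjacency_mat :: "'a pair_pre_digraph \<Rightarrow> (nat \<Rightarrow> 'a) \<Rightarrow> nat \<Rightarrow> bit mat" where
  "adjacency_mat G v n = mat n n (\<lambda>(j, k). if (v j, v k) \<in> parcs G then 1 else 0)"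

text \<open>
  An \<^const>\<open>pre_digraph.apath\<close> is a list of consecutive arcs with pairwise distinct vertices. Between
  two fixed distinct vertices, directed paths of length 2 are in bijection with undirected ones.
\<close>

definition paths2 :: "'a pair_pre_digraph \<Rightarrow> 'a \<Rightarrow> 'a \<Rightarrow> ('a \<times> 'a) awalk set" where
  "paths2 G u w = {p. pre_digraph.apath (with_proj G) u p w \<and> length p = 2}"

definition toggles :: "'a pair_pre_digraph \<Rightarrow> 'a \<Rightarrow> 'a \<Rightarrow> bool" where
  "toggles G u w \<longleftrightarrow> w = u \<or> odd (card (paths2 G u w))"

definition press :: "'a pair_pre_digraph \<Rightarrow> (nat \<Rightarrow> 'a) \<Rightarrow> nat \<Rightarrow> nat \<Rightarrow> bit vec \<Rightarrow> bit vec" where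
  "press G v n j x = vec n (\<lambda>k. if toggles G (v j) (v k) then x $ k + 1 else x $ k)"

definition transformable ::
    "'a pair_pre_digraph \<Rightarrow> (nat \<Rightarrow> 'a) \<Rightarrow> nat \<Rightarrow> bit vec \<Rightarrow> bit vec \<Rightarrow> bool" where
  "transformable G v n x y \<longleftrightarrow> (\<exists>js. set js \<subseteq> {..<n} \<and> fold (press G v n) js x = y)"

end

theory Submission
  imports Defs
begin

text \<open>
  Pressing the button at \<open>v j\<close> adds the \<open>j\<close>-th row of \<open>N\<close> to the state: the entries of \<open>A\<^sup>2\<close> count
  common neighbours modulo 2, and the degree parity makes every diagonal entry of \<open>N\<close> equal to 1.
  Hence \<open>f\<close> is reachable from \<open>i\<close> iff \<open>f - i\<close> lies in the row space of \<open>N\<close>, and by duality this space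
  is the orthogonal complement of the kernel of \<open>N\<close>.
\<close>

text \<open>The default simp set rewrites \<open>+\<close> and \<open>*\<close> on
  \<open>bit\<close> to bit operations; without those rules terms keep the field form that the
  scalar product lemmas need.\<close>

declare add_bit_eq_xor [simp del] mult_bit_eq_and [simp del]

lemma bit_add_self [simp]: "(a :: bit) + a = 0"
  by (cases a) simp_all

lemma of_nat_bit: "(of_nat m :: bit) = (if odd m then 1 else 0)"
  by (induction m) simp_all

section \<open>Reachability, duality and kernels over the two-element field\<close>

lemma bit_vec_add_self:
  fixes x y :: "bit vec"
  assumes "x \<in> carrier_vec n" and "y \<in> carrier_vec n"
  shows "x + y + y = x"
  using assms by (intro eq_vecI) (auto simp: add.assoc)

text \<open>Each step adds a vector annihilated by \<open>w\<close>, so the value of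
  \<open>w\<close> is an invariant of the sequence. This is the easy half of the duality.\<close>

lemma scalar_prod_fold_add:
  fixes c :: "nat \<Rightarrow> 'b :: comm_semiring_0 vec"
  assumes "c \<in> {..<m} \<rightarrow> carrier_vec n" and "x \<in> carrier_vec n" and "set js \<subseteq> {..<m}"
    and "w \<in> carrier_vec n" and "\<forall>j<m. w \<bullet> c j = 0"
  shows "w \<bullet> fold (\<lambda>j z. z + c j) js x = w \<bullet> x"
  using assms(2,3)
proof (induction js arbitrary: x)
  case (Cons j js)
  then have j: "j < m" "c j \<in> carrier_vec n"
    using assms(1) by auto
  then have "w \<bullet> fold (\<lambda>j z. z + c j) js (x + c j) = w \<bullet> (x + c j)"
    using Cons by (intro Cons.IH) auto
  also have "\<dots> = w \<bullet> x"
    using j Cons.prems assms(4,5) by (simp add: scalar_prod_add_distrib[of w n])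
  finally show ?case by simp
qed simp

text \<open>
  In the induction step neither \<open>y\<close> nor \<open>y + c m\<close> is reachable with the first \<open>m\<close> vectors. If both
  of the resulting separating functionals \<open>w1\<close>, \<open>w2\<close> take the value 1 on \<open>c m\<close>, then
  \<open>w1 + w2\<close> vanishes on \<open>c m\<close> and still separates \<open>x\<close> from \<open>y\<close>.
\<close>

lemma separating_functional:
  fixes c :: "nat \<Rightarrow> bit vec"
  assumes "c \<in> {..<m} \<rightarrow> carrier_vec n" and "x \<in> carrier_vec n" and "y \<in> carrier_vec n"
    and "\<nexists>js. set js \<subseteq> {..<m} \<and> fold (\<lambda>j z. z + c j) js x = y"
  shows "\<exists>w \<in> carrier_vec n. (\<forall>j<m. w \<bullet> c j = 0) \<and> w \<bullet> x \<noteq> w \<bullet> y"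
  using assms
proof (induction m arbitrary: y)
  case 0
  then have "x \<noteq> y"
    by auto
  then obtain k where k: "k < n" "x $ k \<noteq> y $ k"
    using 0 by (metis carrier_vecD eq_vecI)
  then have "unit_vec n k \<bullet> x \<noteq> unit_vec n k \<bullet> y"
    using 0 by (simp add: scalar_prod_left_unit)
  then show ?case
    by (auto intro!: bexI[of _ "unit_vec n k"])
next
  case (Suc m)
  have c: "c \<in> {..<m} \<rightarrow> carrier_vec n" "c m \<in> carrier_vec n"
    using Suc.prems(1) by auto
  have "\<nexists>js. set js \<subseteq> {..<m} \<and> fold (\<lambda>j z. z + c j) js x = y"
    using Suc.prems(4) by (metis lessThan_Suc subset_insertI2)
  then obtain w1 where w1: "w1 \<in> carrier_vec n" "\<forall>j<m. w1 \<bullet> c j = 0" "w1 \<bullet> x \<noteq> w1 \<bullet> y"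
    using Suc.IH[OF c(1) Suc.prems(2,3)] by blast
  \<comment> \<open>Over \<open>bit\<close> adding \<open>c m\<close> a second time cancels it, so a
    sequence reaching \<open>y + c m\<close> would reach \<open>y\<close> after one more step
    \<open>m\<close>.\<close>
  have "\<nexists>js. set js \<subseteq> {..<m} \<and> fold (\<lambda>j z. z + c j) js x = y + c m"
  proof
    assume "\<exists>js. set js \<subseteq> {..<m} \<and> fold (\<lambda>j z. z + c j) js x = y + c m"
    then obtain js where js: "set js \<subseteq> {..<m}" "fold (\<lambda>j z. z + c j) js x = y + c m"
      by blast
    then have "fold (\<lambda>j z. z + c j) (js @ [m]) x = y"
      using bit_vec_add_self[OF Suc.prems(3) c(2)] by simp
    moreover have "set (js @ [m]) \<subseteq> {..<Suc m}"
      using js(1) by (auto simp: less_Suc_eq)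
    ultimately show False
      using Suc.prems(4) by blast
  qed
  then obtain w2 where w2: "w2 \<in> carrier_vec n" "\<forall>j<m. w2 \<bullet> c j = 0" "w2 \<bullet> x \<noteq> w2 \<bullet> (y + c m)"
    using Suc.IH[OF c(1) Suc.prems(2), of "y + c m"] Suc.prems(3) c(2) by auto
  have w2': "w2 \<bullet> x \<noteq> w2 \<bullet> y + w2 \<bullet> c m"
    using w2 Suc.prems(3) c(2) by (simp add: scalar_prod_add_distrib[of w2 n])
  consider "w1 \<bullet> c m = 0" | "w2 \<bullet> c m = 0" | "w1 \<bullet> c m = 1" "w2 \<bullet> c m = 1"
    by (metis bit_not_zero_iff)
  then show ?case
  proof cases
    case 1
    then show ?thesis
      using w1 by (auto simp: less_Suc_eq intro!: bexI[of _ w1])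
  next
    case 2
    then show ?thesis
      using w2 w2' by (auto simp: less_Suc_eq intro!: bexI[of _ w2])
  next
    case 3
    have add: "(w1 + w2) \<bullet> z = w1 \<bullet> z + w2 \<bullet> z" if "z \<in> carrier_vec n" for z
      using w1 w2 that by (simp add: add_scalar_prod_distrib[of w1 n])
    \<comment> \<open>Being different from \<open>w2 \<bullet> y + 1\<close> in a two-element field
      means being equal to \<open>w2 \<bullet> y\<close>, so in the sum only \<open>w1\<close>
      separates.\<close>
    have "w2 \<bullet> x = w2 \<bullet> y"
      using w2' 3 by (cases "w2 \<bullet> y"; cases "w2 \<bullet> x") auto
    then have "(w1 + w2) \<bullet> x \<noteq> (w1 + w2) \<bullet> y"
      using w1(3) Suc.prems by (simp add: add)
    moreover have "\<forall>j<Suc m. (w1 + w2) \<bullet> c j = 0"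
      using w1 w2 c 3 by (auto simp: less_Suc_eq add Pi_iff)
    ultimately show ?thesis
      using w1(1) w2(1) by (intro bexI[of _ "w1 + w2"]) auto
  qed
qed

text \<open>The vectors reachable from \<open>x\<close> form the coset of \<open>x\<close> modulo
  the span of the \<open>c j\<close>; the equivalence says that this span is its own double
  annihilator.\<close>

lemma fold_add_reachable_iff:
  fixes c :: "nat \<Rightarrow> bit vec"
  assumes "c \<in> {..<m} \<rightarrow> carrier_vec n" and "x \<in> carrier_vec n" and "y \<in> carrier_vec n"
  shows "(\<exists>js. set js \<subseteq> {..<m} \<and> fold (\<lambda>j z. z + c j) js x = y) \<longleftrightarrow>
    (\<forall>w \<in> carrier_vec n. (\<forall>j<m. w \<bullet> c j = 0) \<longrightarrow> w \<bullet> x = w \<bullet> y)"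
proof
  assume "\<exists>js. set js \<subseteq> {..<m} \<and> fold (\<lambda>j z. z + c j) js x = y"
  then show "\<forall>w \<in> carrier_vec n. (\<forall>j<m. w \<bullet> c j = 0) \<longrightarrow> w \<bullet> x = w \<bullet> y"
    using scalar_prod_fold_add[OF assms(1,2)] by force
next
  assume "\<forall>w \<in> carrier_vec n. (\<forall>j<m. w \<bullet> c j = 0) \<longrightarrow> w \<bullet> x = w \<bullet> y"
  then show "\<exists>js. set js \<subseteq> {..<m} \<and> fold (\<lambda>j z. z + c j) js x = y"
    using separating_functional[OF assms] by blast
qed

text \<open>The kernel vectors orthogonal to \<open>d\<close> form a subspace, which contains the
  span of \<open>B\<close> as soon as it contains \<open>B\<close>. Thus a condition on the whole
  kernel can be tested on a basis.\<close>

lemma (in kernel) gen_set_orthogonal: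
  assumes "gen_set B" and "B \<subseteq> mat_kernel A" and "d \<in> carrier_vec nc"
    and "\<forall>b \<in> B. b \<bullet> d = 0" and "w \<in> mat_kernel A"
  shows "w \<bullet> d = 0"
proof -
  let ?U = "{w \<in> mat_kernel A. w \<bullet> d = 0}"
  have carr: "u \<in> carrier_vec nc" if "u \<in> mat_kernel A" for u
    using that mat_kernel_carrier[OF A] by auto
  have "submodule class_ring ?U VK"
  proof (intro submodule.intro)
    show "Module.module class_ring VK"
      by (rule Ker.module_axioms)
  qed (use assms(3) carr Ker.M.add.m_closed Ker.smult_closed in
      \<open>auto simp: add_scalar_prod_distrib[of _ nc] class_ring_simps\<close>)
  then have "span B \<subseteq> ?U"
    using assms(2,4) by (intro Ker.span_is_subset) auto
  then show ?thesis
    using assms(1,5) by auto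
qed

lemma mult_mat_of_rows_eq_iff:
  assumes "set ws \<subseteq> carrier_vec n"
  shows "mat_of_rows n ws *\<^sub>v x = mat_of_rows n ws *\<^sub>v y \<longleftrightarrow> (\<forall>w \<in> set ws. w \<bullet> x = w \<bullet> y)"
proof -
  have "row (mat_of_rows n ws) k = ws ! k" if "k < length ws" for k
    using that assms by (intro mat_of_rows_row) auto
  then show ?thesis
    by (auto simp: vec_eq_iff all_set_conv_all_nth)
qed

section \<open>Common neighbours and the square of the adjacency matrix\<close>

lemma adjacency_mat_carrier [simp]: "adjacency_mat G v n \<in> carrier_mat n n"
  by (simp add: adjacency_mat_def)

context pair_graph
begin

lemma arc_sym: "(u, w) \<in> parcs G \<longleftrightarrow> (w, u) \<in> parcs G"
  using pair_sym_arcs by (auto simp: symmetric_def sym_def)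

text \<open>Without loops the middle vertex differs from both ends, so for
  \<open>u \<noteq> w\<close> the vertices of any walk of two arcs are distinct.\<close>

lemma paths2_eq:
  assumes "u \<noteq> w"
  shows "paths2 G u w = (\<lambda>z. [(u, z), (z, w)]) ` {z. (u, z) \<in> parcs G \<and> (z, w) \<in> parcs G}"
proof -
  have "p \<in> paths2 G u w \<longleftrightarrow>
      (\<exists>z. p = [(u, z), (z, w)] \<and> (u, z) \<in> parcs G \<and> (z, w) \<in> parcs G)" for p
    using assms pair_no_loops in_arcsD1
    by (fastforce simp: paths2_def apath_def awalk_def length_Suc_conv numeral_2_eq_2)
  then show ?thesis
    by auto
qed

lemma card_paths2:
  assumes "u \<noteq> w"
  shows "card (paths2 G u w) = card {z. (u, z) \<in> parcs G \<and> (z, w) \<in> parcs G}"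
  unfolding paths2_eq[OF assms] by (rule card_image) (auto intro: inj_onI)

text \<open>By symmetry every neighbour of \<open>u\<close> is a common neighbour of
  \<open>u\<close> with itself, which puts the degree in the form of a diagonal entry of the squared
  matrix.\<close>

lemma out_degree_eq: "out_degree (with_proj G) u = card {z. (u, z) \<in> parcs G \<and> (z, u) \<in> parcs G}"
proof -
  have "out_arcs (with_proj G) u = Pair u ` {z. (u, z) \<in> parcs G \<and> (z, u) \<in> parcs G}"
    using arc_sym by (force simp: out_arcs_def)
  then show ?thesis
    by (simp add: out_degree_def card_image inj_on_def)
qed

lemma adjacency_mat_square:
  assumes v: "bij_betw v {..<n} (pverts G)" and "j < n" and "k < n"
  shows "(adjacency_mat G v n ^\<^sub>m 2) $$ (j, k) =
    of_nat (card {z. (v j, z) \<in> parcs G \<and> (z, v k) \<in> parcs G})"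
proof -
  let ?Z = "{z. (v j, z) \<in> parcs G \<and> (z, v k) \<in> parcs G}"
  let ?L = "{l. l < n \<and> v l \<in> ?Z}"
  define A where "A = adjacency_mat G v n"
  have A: "A \<in> carrier_mat n n"
    by (simp add: A_def)
  \<comment> \<open>Matrix products sum over indices, paths run over vertices; since arcs end in
    \<open>pverts G\<close>, \<open>v\<close> matches the indices in \<open>?L\<close> with the
    vertices in \<open>?Z\<close>.\<close>
  have "?Z \<subseteq> v ` {..<n}"
    using v in_arcsD2 by (auto simp: bij_betw_def)
  then have "v ` ?L = ?Z"
    by auto
  moreover have "inj_on v ?L"
    using v by (auto simp: bij_betw_def inj_on_def)
  ultimately have card: "card ?Z = card ?L"
    using card_image[of v ?L] by simp
  have "(adjacency_mat G v n ^\<^sub>m 2) $$ (j, k) = (A * A) $$ (j, k)"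
    using A by (simp add: A_def numeral_2_eq_2)
  also have "\<dots> = (\<Sum>l = 0..<n. A $$ (j, l) * A $$ (l, k))"
    using A assms(2,3) by (simp add: scalar_prod_def)
  also have "\<dots> = (\<Sum>l = 0..<n. of_bool (v l \<in> ?Z))"
    using assms(2,3) by (intro sum.cong) (auto simp: A_def adjacency_mat_def)
  also have "\<dots> = of_nat (card ({0..<n} \<inter> {l. v l \<in> ?Z}))"
    by (subst sum_of_bool_eq) auto
  also have "{0..<n} \<inter> {l. v l \<in> ?Z} = ?L"
    by auto
  finally show ?thesis
    using card by simp
qed

end

theorem theorem3:
  fixes G :: "'a pair_pre_digraph"
    and v :: "nat \<Rightarrow> 'a"
    and n r :: nat
    and A N J :: "bit mat"
    and ws :: "bit vec list"
    and i f :: "bit vec"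
  assumes "pair_graph G"
    and "bij_betw v {..<n} (pverts G)"
    and "A = adjacency_mat G v n"
    and "((\<forall>u \<in> pverts G. even (out_degree (with_proj G) u)) \<and> N = A ^\<^sub>m 2 + 1\<^sub>m n) \<or>
         ((\<forall>u \<in> pverts G. odd (out_degree (with_proj G) u)) \<and> N = A ^\<^sub>m 2)"
    and "r = vec_space.rank n N"
    and "length ws = n - r"
    and "distinct ws"
    and "kernel.basis n N (set ws)"
    and "J = mat_of_rows n ws"
    and "i \<in> carrier_vec n"
    and "f \<in> carrier_vec n"
  shows "transformable G v n i f \<longleftrightarrow> J *\<^sub>v i = J *\<^sub>v f"
proof -
  interpret pair_graph G by fact
  have N: "N \<in> carrier_mat n n"
    using assms(3,4) by auto
  have entry: "N $$ (j, k) = (if toggles G (v j) (v k) then 1 else 0)" if "j < n" "k < n" for j k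
  proof (cases "j = k")
    case True
    have "v j \<in> pverts G"
      using assms(2) that by (auto simp: bij_betw_def)
    \<comment> \<open>A button always toggles its own light, and the entry is indeed 1: an even
      degree contributes 0 and the identity adds 1, an odd degree contributes 1 by itself.\<close>
    then show ?thesis
      using assms(3,4) that True adjacency_mat_square[OF assms(2) that]
      by (auto simp: toggles_def out_degree_eq of_nat_bit)
  next
    case False
    then have "v j \<noteq> v k"
      using assms(2) that by (auto simp: bij_betw_def inj_on_def)
    then show ?thesis
      using assms(3,4) that False adjacency_mat_square[OF assms(2) that]
      by (auto simp: toggles_def card_paths2 of_nat_bit)
  qed
  have press: "press G v n j x = x + row N j" if "j < n" "x \<in> carrier_vec n" for j x
    using that N by (intro eq_vecI) (auto simp: press_def entry)
  have rows: "row N \<in> {..<n} \<rightarrow> carrier_vec n"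
    using N by auto
  have "fold (press G v n) js x = fold (\<lambda>j z. z + row N j) js x"
    if "set js \<subseteq> {..<n}" "x \<in> carrier_vec n" for js x
    using that
  proof (induction js arbitrary: x)
    case (Cons j js)
    then have "x + row N j \<in> carrier_vec n"
      using rows by (simp add: Pi_iff)
    then show ?case
      using Cons by (simp add: press)
  qed simp
  then have "transformable G v n i f \<longleftrightarrow>
      (\<exists>js. set js \<subseteq> {..<n} \<and> fold (\<lambda>j z. z + row N j) js i = f)"
    using assms(10) by (auto simp: transformable_def)
  also have "\<dots> \<longleftrightarrow> (\<forall>w \<in> carrier_vec n. (\<forall>j<n. w \<bullet> row N j = 0) \<longrightarrow> w \<bullet> i = w \<bullet> f)"
    by (rule fold_add_reachable_iff[OF rows assms(10,11)])
  also have "\<dots> \<longleftrightarrow> (\<forall>w \<in> mat_kernel N. w \<bullet> i = w \<bullet> f)"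
  proof -
    \<comment> \<open>The entries of \<open>N *\<^sub>v w\<close> are the scalar products of
      \<open>w\<close> with the rows, so the kernel is the annihilator of the rows.\<close>
    have "w \<in> mat_kernel N \<longleftrightarrow> w \<in> carrier_vec n \<and> (\<forall>j<n. w \<bullet> row N j = 0)" for w
      using N by (auto simp: mat_kernel[OF N] vec_eq_iff comm_scalar_prod[of w n])
    then show ?thesis
      by auto
  qed
  also have "\<dots> \<longleftrightarrow> (\<forall>w \<in> set ws. w \<bullet> i = w \<bullet> f)"
  proof -
    interpret kernel n n N by (rule kernel.intro) fact
    have ws: "gen_set (set ws)" "set ws \<subseteq> mat_kernel N"
      using assms(8) by (auto simp: Ker.basis_def)
    \<comment> \<open>Agreement on \<open>i\<close> and \<open>f\<close> becomes orthogonality to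
      the single vector \<open>i - f\<close>; subtraction is kept unexpanded so that a zero
      difference reads as equality.\<close>
    have diff: "w \<bullet> (i - f) = 0 \<longleftrightarrow> w \<bullet> i = w \<bullet> f" if "w \<in> mat_kernel N" for w
      using that assms(10,11) mat_kernel_carrier[OF N]
      by (subst scalar_prod_minus_distrib[of _ n]) (auto simp del: minus_bit_def)
    have "i - f \<in> carrier_vec n"
      using assms(10,11) by simp
    from gen_set_orthogonal[OF ws this] show ?thesis
      using ws(2) diff by (metis subsetD)
  qed
  also have "\<dots> \<longleftrightarrow> J *\<^sub>v i = J *\<^sub>v f"
  proof -
    interpret kernel n n N by (rule kernel.intro) fact
    have "set ws \<subseteq> carrier_vec n"
      using assms(8) mat_kernel_carrier[OF N] by (auto simp: Ker.basis_def)
    then show ?thesis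
      unfolding assms(9) by (rule mult_mat_of_rows_eq_iff[symmetric])
  qed
  finally show ?thesis .
qed

end
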